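(* Let $\mathcal{C}$ be a finite, pure, rank-$k$ polyhedral complex in which every maximal face is the same simple polytope (that is, the maximal faces are all combinatorially equivalent to one fixed simple polytope). Let $\sigma = (\sigma_1, \ldots, \sigma_m)$ be a composition of $k$, and let $\pi = (\pi_1, \ldots, \pi_m)$ be a permutation of $\sigma$ (that is, a rearrangement of its entries). If $\pi_1 \geq \sigma_1$, then $$d^{\,\sigma}(\mathcal{C}) \succeq d^{\,\pi}(\mathcal{C}),$$ where $d^{\,\sigma}(\mathcal{C})$ and $d^{\,\pi}(\mathcal{C})$ are the face-to-flag degree sequences and $\succeq$ denotes weak majorization.
   Context: A composition of $k$ is a finite sequence of positive integers with sum $k$. Faces of a polyhedral complex are polytopes; the rank of a face is one more than its dimension (so the empty face has rank $0$ and vertices have rank $1$), and the complex is pure of rank $k$ if every maximal face has rank $k$. Faces are ordered by inclusion. A polytope is simple if every proper upper interval $[x,\hat{1}]$, $x \ne \hat{0}$, in its face lattice is a boolean algebra. Two polytopes are combinatorially equivalent if their face lattices are isomorphic. For a composition $\sigma = (\sigma_1,\ldots,\sigma_m)$ of $k$ and a face $F$ of rank $\sigma_1$, let $d^{\,\sigma}(F)$ be the number of flags $F = X_1 \subset X_2 \subset \cdots \subset X_m$ of faces of $\mathcal{C}$ with ${\rm rk}(X_j) = \sigma_1 + \sigma_2 + \cdots + \sigma_j$ for every $j$. The face-to-flag degree sequence is $d^{\,\sigma}(\mathcal{C}) = (d^{\,\sigma}(F_1), \ldots, d^{\,\sigma}(F_s))$, where $F_1,\ldots,F_s$ are all the rank-$\sigma_1$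 faces of $\mathcal{C}$, indexed so that $d^{\,\sigma}(F_1) \ge d^{\,\sigma}(F_2) \ge \cdots \ge d^{\,\sigma}(F_s)$. For sequences of nonnegative integers $a = (a_1,\ldots,a_n)$ and $b=(b_1,\ldots,b_{n'})$ (possibly of different lengths), $a$ weakly majorizes $b$, written $a \succeq b$, if $a_1 + \cdots + a_r \ge b_1 + \cdots + b_r$ for all $1 \le r \le n-1$, with the convention $b_i = 0$ for $i > n'$, and $\sum_i a_i \ge \sum_i b_i$. *)

theory Defs
  imports "HOL-Analysis.Polytope" "HOL-Library.Multiset"
begin

section \<open>Polytopes and their face lattices\<close>

definition faces :: "'a::euclidean_space set \<Rightarrow> 'a set set" where
  "faces P = {F. F face_of P}"

text \<open>Order isomorphism of two families of sets, both ordered by inclusion.\<close>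

definition incl_isomorphic :: "'a set set \<Rightarrow> 'b set set \<Rightarrow> bool" where
  "incl_isomorphic A B \<longleftrightarrow>
     (\<exists>f. bij_betw f A B \<and> (\<forall>X\<in>A. \<forall>Y\<in>A. X \<subseteq> Y \<longleftrightarrow> f X \<subseteq> f Y))"

definition comb_equivalent :: "'a::euclidean_space set \<Rightarrow> 'b::euclidean_space set \<Rightarrow> bool" where
  "comb_equivalent P Q \<longleftrightarrow> incl_isomorphic (faces P) (faces Q)"

text \<open>As usual for face posets, a (finite) boolean algebra is a poset isomorphic to the poset of all
  subsets of an \<open>n\<close>-element set, for some \<open>n \<ge> 0\<close>.\<close>

definition boolean_family :: "'a set set \<Rightarrow> bool" where
  "boolean_family A \<longleftrightarrow> (\<exists>n::nat. incl_isomorphic A (Pow {..<n}))"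

definition simple_polytope :: "'a::euclidean_space set \<Rightarrow> bool" where
  "simple_polytope P \<longleftrightarrow>
     polytope P \<and>
     (\<forall>X\<in>faces P. X \<noteq> {} \<longrightarrow> boolean_family {F \<in> faces P. X \<subseteq> F})"

text \<open>The conversion to \<open>nat\<close> loses nothing, since \<^term>\<open>aff_dim F \<ge> -1\<close>,
  with equality exactly for the empty face.\<close>

definition face_rank :: "'a::euclidean_space set \<Rightarrow> nat" where
  "face_rank F = nat (aff_dim F + 1)"


section \<open>Polyhedral complexes\<close>

text \<open>As \<^const>\<open>simplicial_complex\<close>, with polytopes in place of simplices and without the finiteness
  condition. Since \<^prop>\<open>{} face_of S\<close>, every nonempty complex contains the empty face.\<close>

definition polyhedral_complex :: "'a::euclidean_space set set \<Rightarrow> bool" where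
  "polyhedral_complex C \<longleftrightarrow>
     (\<forall>S\<in>C. polytope S) \<and>
     (\<forall>S\<in>C. \<forall>F. F face_of S \<longrightarrow> F \<in> C) \<and>
     (\<forall>S\<in>C. \<forall>T\<in>C. (S \<inter> T) face_of S \<and> (S \<inter> T) face_of T)"

definition maximal_faces :: "'a set set \<Rightarrow> 'a set set" where
  "maximal_faces C = {F \<in> C. \<forall>G\<in>C. F \<subseteq> G \<longrightarrow> F = G}"

definition pure_of_rank :: "nat \<Rightarrow> 'a::euclidean_space set set \<Rightarrow> bool" where
  "pure_of_rank k C \<longleftrightarrow> (\<forall>F\<in>maximal_faces C. face_rank F = k)"


section \<open>Compositions and flag degrees\<close>

definition is_composition :: "nat list \<Rightarrow> nat \<Rightarrow> bool" where
  "is_composition \<sigma> k \<longleftrightarrow> (\<forall>s\<in>set \<sigma>. 0 < s) \<and> sum_list \<sigma> = k"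

text \<open>Lists are indexed from 0, so the \<open>j\<close>-th entry of a flag has the rank given by the sum of the
  first \<open>j + 1\<close> entries of the composition.\<close>

definition flags_from :: "'a::euclidean_space set set \<Rightarrow> nat list \<Rightarrow> 'a set \<Rightarrow> 'a set list set" where
  "flags_from C \<sigma> F =
     {X. length X = length \<sigma> \<and> set X \<subseteq> C \<and> X ! 0 = F \<and> sorted_wrt (\<subset>) X \<and>
         (\<forall>j<length \<sigma>. face_rank (X ! j) = sum_list (take (Suc j) \<sigma>))}"

definition flag_degree :: "'a::euclidean_space set set \<Rightarrow> nat list \<Rightarrow> 'a set \<Rightarrow> nat" where
  "flag_degree C \<sigma> F = card (flags_from C \<sigma> F)"

text \<open>The degrees of all faces of rank \<^term>\<open>hd \<sigma>\<close>, with multiplicity and in decreasing order.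
  Only meaningful for a finite complex and a nonempty composition.\<close>

definition degree_sequence :: "'a::euclidean_space set set \<Rightarrow> nat list \<Rightarrow> nat list" where
  "degree_sequence C \<sigma> =
     rev (sorted_list_of_multiset
       (image_mset (flag_degree C \<sigma>) (mset_set {F \<in> C. face_rank F = hd \<sigma>})))"

text \<open>For \<open>r > length b\<close> the term \<^term>\<open>take r b\<close> is all of \<open>b\<close>, which amounts to padding \<open>b\<close> with
  zeros.\<close>

definition weakly_majorizes :: "nat list \<Rightarrow> nat list \<Rightarrow> bool" where
  "weakly_majorizes a b \<longleftrightarrow>
     (\<forall>r. 1 \<le> r \<and> r < length a \<longrightarrow> sum_list (take r a) \<ge> sum_list (take r b)) \<and>
     sum_list a \<ge> sum_list b"

end

theory Submission
  imports Defs
begin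

text \<open>
  Write \<open>N(F)\<close> for the number of maximal faces containing a face \<open>F\<close>. Below a fixed maximal face \<open>Q\<close>,
  the interval from a nonempty face to \<open>Q\<close> is a boolean algebra graded by rank, so a flag starting
  at a face \<open>F\<close> of rank \<open>a = \<sigma>\<^sub>1\<close> can be completed to \<open>Q\<close> in a number of ways that depends only on
  \<open>\<sigma>\<close>. Hence \<open>d\<^sup>\<sigma>(F) = M\<^sub>a N(F)\<close> with \<open>M\<^sub>a = a! (k - a)! / D\<close>, where \<open>D\<close>, the product of the factorials
  of all parts, is the same for \<open>\<sigma>\<close> and its permutation \<open>\<pi>\<close> (lemma \<open>flag_degree_eq\<close>).

  Weak majorization follows from the inequalities
  \<open>\<Sum>\<^sub>F max 0 (d\<^sup>\<sigma>(F) - t) \<ge> \<Sum>\<^sub>G max 0 (d\<^sup>\<pi>(G) - t)\<close> for all thresholds \<open>t\<close>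
  (lemma \<open>weakly_majorizes_if_truncated_sums_le\<close>); here \<open>F\<close> ranges over the faces of rank \<open>a\<close> and
  \<open>G\<close> over those of rank \<open>b = \<pi>\<^sub>1 \<ge> a\<close>. To prove them, put \<open>w(F) = max 0 (M\<^sub>a - t / N(F))\<close>, so that the left
  side is \<open>\<Sum>\<^sub>F N(F) w(F)\<close>, and count pairs \<open>F \<subseteq> G\<close>. Three facts enter:

  \<^item> the sum of \<open>N(G)\<close> over the rank \<open>b\<close> faces \<open>G \<supseteq> F\<close> is \<open>U N(F)\<close> with \<open>U = (k - a) choose (b - a)\<close>
    (lemma \<open>sum_maximal_degree_above\<close>);
  \<^item> each \<open>G\<close> of rank \<open>b\<close> has at least \<open>L = b choose a\<close> faces of rank \<open>a\<close>, as many as a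
    simplex of its dimension (lemma \<open>choose_le_card_faces\<close>);
  \<^item> \<open>N\<close>, and with it \<open>w\<close>, can only decrease when a face grows.

  Therefore \<open>U \<Sum>\<^sub>F N(F) w(F) = \<Sum>\<^sub>G N(G) (\<Sum>\<^sub>F\<^sub>\<subseteq>\<^sub>G w(F)) \<ge> L \<Sum>\<^sub>G max 0 (M\<^sub>a N(G) - t)\<close>. Since
  \<open>M\<^sub>a L = M\<^sub>b U\<close>, the term \<open>L max 0 (M\<^sub>a N(G) - t)\<close> is at least \<open>U max 0 (M\<^sub>b N(G) - t)\<close> as soon as
  \<open>L \<le> U\<close>. This last inequality is where \<open>\<pi>\<close> being a rearrangement of \<open>\<sigma>\<close> is used again: if \<open>a \<noteq> b\<close>, then both are parts
  of one composition of \<open>k\<close>, so \<open>b \<le> k - a\<close>.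
\<close>


section \<open>Faces of a simple polytope\<close>

lemma face_rank_pos:
  assumes "F \<noteq> {}"
  shows "0 < face_rank F"
  using assms aff_dim_negative_iff[of F] by (simp add: face_rank_def del: aff_dim_negative_iff)

lemma face_rank_mono: "F \<subseteq> G \<Longrightarrow> face_rank F \<le> face_rank G"
  by (simp add: face_rank_def aff_dim_subset nat_mono)

lemma face_eq_if_face_rank_eq:
  assumes "convex G" "F face_of G" "face_rank F = face_rank G"
  shows "F = G"
proof (rule ccontr)
  assume "F \<noteq> G"
  then have "aff_dim F < aff_dim G"
    using assms face_of_aff_dim_lt by blast
  with assms(3) show False
    using aff_dim_geq[of F] by (simp add: face_rank_def)
qed

lemma face_rank_facet_of:
  assumes "H facet_of G"
  shows "face_rank G = Suc (face_rank H)"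
  using assms aff_dim_negative_iff[of H]
  by (auto simp: facet_of_def face_rank_def simp del: aff_dim_negative_iff)

lemma facet_of_between:
  assumes "convex G" "H facet_of G" "K face_of G" "H \<subseteq> K"
  shows "K = H \<or> K = G"
proof -
  have "H face_of K"
    using assms face_of_face facet_of_imp_face_of by blast
  moreover have "face_rank K = face_rank H \<or> face_rank K = face_rank G"
    using assms face_rank_facet_of[of H G] face_rank_mono[of H K] face_rank_mono[of K G]
      face_of_imp_subset[of K G] by linarith
  ultimately show ?thesis
    using assms face_eq_if_face_rank_eq face_of_imp_convex by metis
qed

lemma simple_polytope_comb_equivalent:
  assumes "polytope Q" "comb_equivalent Q P" "simple_polytope P"
  shows "simple_polytope Q"
  unfolding simple_polytope_def
proof (intro conjI ballI impI)
  show "polytope Q" by fact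
next
  fix X assume X: "X \<in> faces Q" "X \<noteq> {}"
  obtain f where f: "bij_betw f (faces Q) (faces P)"
    and f_mono: "\<And>X Y. X \<in> faces Q \<Longrightarrow> Y \<in> faces Q \<Longrightarrow> X \<subseteq> Y \<longleftrightarrow> f X \<subseteq> f Y"
    using assms(2) by (auto simp: comb_equivalent_def incl_isomorphic_def)
  have fX: "f X \<in> faces P"
    using f X bij_betwE by blast
  \<comment> \<open>The empty face lies below all faces of \<open>Q\<close>, and an isomorphism preserves this.\<close>
  have "f X \<noteq> {}"
  proof
    assume "f X = {}"
    moreover have "{} \<in> faces Q" by (simp add: faces_def)
    ultimately have "X \<subseteq> {}"
      using f_mono X by blast
    with X show False by simp
  qed
  then obtain n g where g: "bij_betw g {F \<in> faces P. f X \<subseteq> F} (Pow {..<n::nat})"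
    and g_mono: "\<And>A B. A \<in> {F \<in> faces P. f X \<subseteq> F} \<Longrightarrow> B \<in> {F \<in> faces P. f X \<subseteq> F} \<Longrightarrow>
                   A \<subseteq> B \<longleftrightarrow> g A \<subseteq> g B"
    using assms(3) fX unfolding simple_polytope_def boolean_family_def incl_isomorphic_def
    by meson
  have f_up: "bij_betw f {F \<in> faces Q. X \<subseteq> F} {F \<in> faces P. f X \<subseteq> F}"
  proof (rule bij_betw_subset[OF f, THEN bij_betw_cong[THEN iffD1, rotated]])
    show "f ` {F \<in> faces Q. X \<subseteq> F} = {F \<in> faces P. f X \<subseteq> F}"
    proof
      show "f ` {F \<in> faces Q. X \<subseteq> F} \<subseteq> {F \<in> faces P. f X \<subseteq> F}"
        using f f_mono X bij_betwE by fast
      show "{F \<in> faces P. f X \<subseteq> F} \<subseteq> f ` {F \<in> faces Q. X \<subseteq> F}"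
      proof
        fix Y assume Y: "Y \<in> {F \<in> faces P. f X \<subseteq> F}"
        then obtain Z where "Z \<in> faces Q" "Y = f Z"
          using bij_betw_imp_surj_on[OF f] by blast
        then show "Y \<in> f ` {F \<in> faces Q. X \<subseteq> F}"
          using Y f_mono X by blast
      qed
    qed
  qed auto
  have "bij_betw (g \<circ> f) {F \<in> faces Q. X \<subseteq> F} (Pow {..<n})"
    using f_up g by (rule bij_betw_trans)
  moreover have "A \<subseteq> B \<longleftrightarrow> (g \<circ> f) A \<subseteq> (g \<circ> f) B"
    if "A \<in> {F \<in> faces Q. X \<subseteq> F}" "B \<in> {F \<in> faces Q. X \<subseteq> F}" for A B
    using that f_mono g_mono bij_betwE[OF f_up] by simp
  ultimately show "boolean_family {F \<in> faces Q. X \<subseteq> F}"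
    unfolding boolean_family_def incl_isomorphic_def by blast
qed

text \<open>The boolean algebra above a nonempty face \<open>X\<close> is graded by the difference of ranks: any face
  other than \<open>X\<close> in it covers one of its own facets containing \<open>X\<close>.\<close>

lemma card_interval_faces:
  assumes Q: "simple_polytope Q"
    and X: "X face_of Q" "X \<noteq> {}" and Y: "Y face_of Q" "X \<subseteq> Y"
    and j: "face_rank X \<le> j"
  shows "card {F. F face_of Q \<and> X \<subseteq> F \<and> F \<subseteq> Y \<and> face_rank F = j} =
         (face_rank Y - face_rank X) choose (j - face_rank X)"
proof -
  define I where "I = {F \<in> faces Q. X \<subseteq> F}"
  have poly: "polytope Q"
    using Q by (simp add: simple_polytope_def)
  have "boolean_family I"
    using Q X by (simp add: simple_polytope_def I_def faces_def)
  then obtain n f where f: "bij_betw f I (Pow {..<n::nat})"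
    and f_mono: "\<And>A B. A \<in> I \<Longrightarrow> B \<in> I \<Longrightarrow> A \<subseteq> B \<longleftrightarrow> f A \<subseteq> f B"
    unfolding boolean_family_def incl_isomorphic_def by metis
  have XI: "X \<in> I"
    using X by (simp add: I_def faces_def)
  have fin: "finite (f A)" if "A \<in> I" for A
    using bij_betwE[OF f] that by (meson PowD finite_lessThan finite_subset)
  have "f X = {}"
  proof -
    have "{} \<in> f ` I"
      by (simp add: bij_betw_imp_surj_on[OF f])
    then obtain Z where Z: "Z \<in> I" "f Z = {}"
      by force
    then have "X \<subseteq> Z" by (simp add: I_def)
    then show ?thesis
      using Z XI f_mono by blast
  qed
  \<comment> \<open>The rank in the face lattice is the rank in the boolean algebra, up to a shift.\<close>
  have rank: "face_rank A = face_rank X + card (f A)" if "A \<in> I" for A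
    using that
  proof (induction "face_rank A" arbitrary: A rule: less_induct)
    case less
    show ?case
    proof (cases "A = X")
      case True
      then show ?thesis using \<open>f X = {}\<close> by simp
    next
      case False
      have A: "A face_of Q" "X \<subseteq> A"
        using less.prems by (auto simp: I_def faces_def)
      have polyA: "polytope A"
        using A poly face_of_polytope_polytope by blast
      have "X face_of A"
        using A X face_of_face by blast
      then obtain H where H: "H facet_of A" "X \<subseteq> H"
        using face_of_polyhedron_subset_facet[of A X] X False polyA polytope_imp_polyhedron by metis
      then have HI: "H \<in> I"
        using face_of_trans[OF facet_of_imp_face_of[OF H(1)] A(1)] by (simp add: I_def faces_def)
      have H_sub: "H \<subset> A"
        using facet_of_imp_subset[OF H(1)] H(1) by (auto simp: psubset_eq)
      have f_sub: "f H \<subset> f A"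
        using HI H_sub f_mono[of H A] f_mono[of A H] less.prems by blast
      \<comment> \<open>Add one element of \<open>f A\<close> to \<open>f H\<close>: the resulting set is the image of a face between
        \<open>H\<close> and \<open>A\<close> other than \<open>H\<close>, which must be \<open>A\<close> as \<open>H\<close> is a facet.\<close>
      have "card (f A) = Suc (card (f H))"
      proof -
        obtain x where x: "x \<in> f A" "x \<notin> f H"
          using f_sub by blast
        then have "insert x (f H) \<in> Pow {..<n}"
          using f_sub bij_betw_apply[OF f less.prems] by blast
        then obtain K where K: "K \<in> I" "f K = insert x (f H)"
          unfolding bij_betw_imp_surj_on[OF f, symmetric] by force
        then have "H \<subseteq> K" "K \<subseteq> A"
          using f_mono[OF HI K(1)] f_mono[OF K(1) less.prems] K(2) x f_sub by auto
        moreover have "K face_of A"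
          using K(1) A(1) \<open>K \<subseteq> A\<close> by (simp add: I_def faces_def face_of_face)
        moreover have "K \<noteq> H"
          using K(2) x by blast
        ultimately have "K = A"
          using facet_of_between[OF polytope_imp_convex[OF polyA] H(1)] by blast
        then show ?thesis
          using K x fin[OF HI] by simp
      qed
      then show ?thesis
        using less.hyps[of H] HI face_rank_facet_of[OF H(1)] by simp
    qed
  qed
  have YI: "Y \<in> I"
    using Y by (simp add: I_def faces_def)
  have "bij_betw f {F. F face_of Q \<and> X \<subseteq> F \<and> F \<subseteq> Y \<and> face_rank F = j}
          {B. B \<subseteq> f Y \<and> card B = j - face_rank X}"
  proof (rule bij_betw_imageI)
    show "inj_on f {F. F face_of Q \<and> X \<subseteq> F \<and> F \<subseteq> Y \<and> face_rank F = j}"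
      by (rule inj_on_subset[OF bij_betw_imp_inj_on[OF f]]) (auto simp: I_def faces_def)
    show "f ` {F. F face_of Q \<and> X \<subseteq> F \<and> F \<subseteq> Y \<and> face_rank F = j} =
          {B. B \<subseteq> f Y \<and> card B = j - face_rank X}"
    proof (intro equalityI subsetI)
      fix B assume "B \<in> f ` {F. F face_of Q \<and> X \<subseteq> F \<and> F \<subseteq> Y \<and> face_rank F = j}"
      then obtain F where "F \<in> I" "F \<subseteq> Y" "face_rank F = j" "B = f F"
        by (auto simp: I_def faces_def)
      then show "B \<in> {B. B \<subseteq> f Y \<and> card B = j - face_rank X}"
        using rank[of F] f_mono[OF _ YI] by auto
    next
      fix B assume B: "B \<in> {B. B \<subseteq> f Y \<and> card B = j - face_rank X}"
      then have "B \<in> Pow {..<n}"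
        using bij_betw_apply[OF f YI] by blast
      then obtain F where F: "F \<in> I" "f F = B"
        unfolding bij_betw_imp_surj_on[OF f, symmetric] by blast
      then have "F \<subseteq> Y"
        using B f_mono[OF F(1) YI] by simp
      moreover have "face_rank F = j"
        using rank[of F] F B j by simp
      ultimately show "B \<in> f ` {F. F face_of Q \<and> X \<subseteq> F \<and> F \<subseteq> Y \<and> face_rank F = j}"
        using F by (auto simp: I_def faces_def)
    qed
  qed
  then have "card {F. F face_of Q \<and> X \<subseteq> F \<and> F \<subseteq> Y \<and> face_rank F = j} =
        card {B. B \<subseteq> f Y \<and> card B = j - face_rank X}"
    by (rule bij_betw_same_card)
  also have "\<dots> = card (f Y) choose (j - face_rank X)"
    by (rule n_subsets[OF fin[OF YI]])
  also have "card (f Y) = face_rank Y - face_rank X"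
    using rank[OF YI] by simp
  finally show ?thesis .
qed

text \<open>A vertex \<open>w \<noteq> v\<close> is the intersection of the facets containing it, so one of these misses \<open>v\<close>.\<close>

lemma facet_avoiding_vertex:
  assumes "polytope G" "2 \<le> face_rank G"
  obtains H where "H facet_of G" "v \<notin> H"
proof -
  have G: "compact G" "convex G"
    using assms polytope_imp_compact polytope_imp_convex by auto
  obtain w where w: "w extreme_point_of G" "w \<noteq> v"
  proof -
    have "{x. x extreme_point_of G} \<subseteq> {v} \<Longrightarrow> False"
    proof -
      assume "{x. x extreme_point_of G} \<subseteq> {v}"
      then have "G \<subseteq> {v}"
        using Krein_Milman_Minkowski[OF G] hull_mono[of "{x. x extreme_point_of G}" "{v}" convex]
        by simp
      then have "face_rank G \<le> face_rank {v}"
        by (rule face_rank_mono)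
      then show False
        using assms by (simp add: face_rank_def)
    qed
    then show thesis using that by blast
  qed
  have "{w} \<noteq> G"
    using assms by (auto simp: face_rank_def)
  then have "{w} = \<Inter>{F. F facet_of G \<and> {w} \<subseteq> F}"
    using face_of_polyhedron[OF polytope_imp_polyhedron[OF assms(1)], of "{w}"] w(1)
    unfolding face_of_singleton by blast
  moreover have "v \<notin> {w}"
    using w(2) by simp
  ultimately have "v \<notin> \<Inter>{F. F facet_of G \<and> {w} \<subseteq> F}"
    by metis
  then show thesis
    using that by auto
qed

text \<open>Faces of a simple polytope have at least as many faces of each positive rank as a simplex of
  the same dimension. The induction splits the faces of \<open>G\<close> by whether they contain a fixed vertex
  \<open>v\<close>: those that do are counted exactly by the boolean interval above \<open>v\<close>, and those that do not
  include all faces of a facet avoiding \<open>v\<close>. Pascal's rule adds up the two bounds.\<close>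

lemma choose_le_card_faces:
  assumes Q: "simple_polytope Q" and "G face_of Q" "G \<noteq> {}" and a: "0 < a"
  shows "face_rank G choose a \<le> card {F. F face_of G \<and> face_rank F = a}"
  using assms(2,3)
proof (induction "face_rank G" arbitrary: G rule: less_induct)
  case less
  have polyQ: "polytope Q"
    using Q by (simp add: simple_polytope_def)
  then have poly: "polytope G"
    using less.prems face_of_polytope_polytope by blast
  have fin: "finite {F. F face_of G \<and> face_rank F = a}"
    by (rule finite_subset[OF _ finite_polytope_faces[OF poly]]) auto
  obtain v where v: "v extreme_point_of G"
    using extreme_point_exists_convex[of G] poly less.prems polytope_imp_compact
      polytope_imp_convex by metis
  then have vG: "{v} face_of G"
    by (simp add: face_of_singleton)
  then have vQ: "{v} face_of Q"
    using less.prems face_of_trans by blast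
  let ?V = "{F. F face_of G \<and> v \<in> F \<and> face_rank F = a}"
  let ?A = "{F. F face_of G \<and> v \<notin> F \<and> face_rank F = a}"
  have rank_v: "face_rank {v} = 1"
    by (simp add: face_rank_def)
  have "?V = {F. F face_of Q \<and> {v} \<subseteq> F \<and> F \<subseteq> G \<and> face_rank F = a}"
    using less.prems(1) by (auto simp: face_of_face)
  then have V: "card ?V = (face_rank G - 1) choose (a - 1)"
    using card_interval_faces[OF Q vQ, of G a] less.prems vG a rank_v face_of_imp_subset by force
  have A: "(face_rank G - 1) choose a \<le> card ?A"
  proof (cases "2 \<le> face_rank G")
    case True
    then obtain H where H: "H facet_of G" "v \<notin> H"
      using facet_avoiding_vertex poly by blast
    have rank_H: "face_rank G = Suc (face_rank H)"
      using face_rank_facet_of[OF H(1)] .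
    have "H \<noteq> {}" "H face_of G"
      using H(1) by (auto simp: facet_of_def)
    then have "face_rank H choose a \<le> card {F. F face_of H \<and> face_rank F = a}"
      using less.hyps[of H] rank_H less.prems face_of_trans by force
    also have "\<dots> \<le> card ?A"
    proof (rule card_mono)
      show "finite ?A"
        using fin by (rule rev_finite_subset) auto
      show "{F. F face_of H \<and> face_rank F = a} \<subseteq> ?A"
        using H \<open>H face_of G\<close> face_of_trans face_of_imp_subset by blast
    qed
    finally show ?thesis
      using rank_H by simp
  next
    case False
    then have "(face_rank G - 1) choose a = 0"
      using a by (intro binomial_eq_0) simp
    then show ?thesis by linarith
  qed
  have "{F. F face_of G \<and> face_rank F = a} = ?V \<union> ?A" by auto
  then have "card {F. F face_of G \<and> face_rank F = a} = card (?V \<union> ?A)"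
    by (rule arg_cong)
  also have "\<dots> = card ?V + card ?A"
    by (rule card_Un_disjoint) (auto intro: rev_finite_subset[OF fin])
  also have "\<dots> \<ge> face_rank G choose a"
    using V A a face_rank_pos[OF less.prems(2)]
      binomial_eq_0 choose_reduce_nat[of "face_rank G" a] by simp
  finally show ?case .
qed


section \<open>Pure complexes with simple maximal faces\<close>

text \<open>Simplicity of each maximal face suffices for the counting of flags: the maximal faces are not
  required to be combinatorially equivalent to each other.\<close>

locale pure_simple_complex =
  fixes C :: "'a::euclidean_space set set" and k :: nat
  assumes finite_complex: "finite C"
    and complex: "polyhedral_complex C"
    and pure: "pure_of_rank k C"
    and simple: "Q \<in> maximal_faces C \<Longrightarrow> simple_polytope Q"
begin

text \<open>The faces of rank \<open>j\<close> of the complex.\<close>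

definition rank_faces :: "nat \<Rightarrow> 'a set set" where
  "rank_faces j = {F \<in> C. face_rank F = j}"

text \<open>The number \<open>N(F)\<close> of maximal faces containing \<open>F\<close>.\<close>

definition maximal_degree :: "'a set \<Rightarrow> nat" where
  "maximal_degree F = card {Q \<in> maximal_faces C. F \<subseteq> Q}"

lemma finite_rank_faces: "finite (rank_faces j)"
  using finite_complex by (simp add: rank_faces_def)

lemma finite_maximal_faces: "finite (maximal_faces C)"
  using finite_complex by (simp add: maximal_faces_def)

lemma maximal_faces_in_complex: "Q \<in> maximal_faces C \<Longrightarrow> Q \<in> C"
  by (simp add: maximal_faces_def)

lemma polytope_in_complex: "F \<in> C \<Longrightarrow> polytope F"
  using complex by (simp add: polyhedral_complex_def)

lemma face_of_in_complex: "S \<in> C \<Longrightarrow> F face_of S \<Longrightarrow> F \<in> C"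
  using complex by (auto simp: polyhedral_complex_def)

lemma face_of_iff_subset:
  assumes "G \<in> C"
  shows "F face_of G \<longleftrightarrow> F \<in> C \<and> F \<subseteq> G"
proof
  assume "F \<in> C \<and> F \<subseteq> G"
  then have "(F \<inter> G) face_of G" "F \<inter> G = F"
    using complex assms by (auto simp: polyhedral_complex_def)
  then show "F face_of G" by simp
qed (use assms face_of_in_complex face_of_imp_subset in blast)

lemma face_rank_maximal: "Q \<in> maximal_faces C \<Longrightarrow> face_rank Q = k"
  using pure by (simp add: pure_of_rank_def)

lemma maximal_above:
  assumes "F \<in> C"
  obtains Q where "Q \<in> maximal_faces C" "F \<subseteq> Q"
proof -
  obtain Q where "Q \<in> C" "F \<subseteq> Q" "\<forall>G\<in>C. Q \<subseteq> G \<longrightarrow> Q = G"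
    using finite_has_maximal2[OF finite_complex assms] by auto
  then show thesis
    using that by (simp add: maximal_faces_def)
qed

lemma maximal_degree_pos:
  assumes "F \<in> C"
  shows "0 < maximal_degree F"
  unfolding maximal_degree_def card_gt_0_iff
  using maximal_above[OF assms] finite_maximal_faces by auto

lemma maximal_degree_antimono:
  assumes "F \<subseteq> G"
  shows "maximal_degree G \<le> maximal_degree F"
  unfolding maximal_degree_def
  by (rule card_mono) (use finite_maximal_faces assms in auto)

text \<open>Faces of the top rank \<open>k\<close> are themselves maximal.\<close>

lemma maximal_degree_top:
  assumes "F \<in> rank_faces k"
  shows "maximal_degree F = 1"
proof -
  have F: "F \<in> C" "face_rank F = k"
    using assms by (auto simp: rank_faces_def)
  have only: "Q = F" if "Q \<in> maximal_faces C" "F \<subseteq> Q" for Q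
  proof -
    have "Q \<in> C"
      using that maximal_faces_in_complex by blast
    then have "F face_of Q" "convex Q"
      using that F face_of_iff_subset polytope_in_complex polytope_imp_convex by blast+
    then show ?thesis
      using face_eq_if_face_rank_eq[of Q F] F face_rank_maximal that by simp
  qed
  obtain Q where "Q \<in> maximal_faces C" "F \<subseteq> Q"
    using maximal_above F by blast
  with only have "{Q \<in> maximal_faces C. F \<subseteq> Q} = {F}" by auto
  then show ?thesis by (simp add: maximal_degree_def)
qed

text \<open>Double counting of the pairs of a rank \<open>j\<close> face \<open>G\<close> and a maximal face \<open>Q\<close> with
  \<open>F \<subseteq> G \<subseteq> Q\<close>. This identity serves both to count flags and to compare the two degree
  sequences.\<close>

lemma sum_maximal_degree_above:
  assumes F: "F \<in> rank_faces s" and s: "0 < s" "s \<le> j"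
  shows "(\<Sum>G | G \<in> rank_faces j \<and> F \<subseteq> G. maximal_degree G) =
         ((k - s) choose (j - s)) * maximal_degree F"
proof -
  have FC: "F \<in> C" "face_rank F = s" "F \<noteq> {}"
    using F s by (auto simp: rank_faces_def face_rank_def)
  let ?G = "{G. G \<in> rank_faces j \<and> F \<subseteq> G}"
  have finG: "finite ?G"
    using finite_rank_faces by simp
  have inQ: "card {G \<in> ?G. G \<subseteq> Q} = (if F \<subseteq> Q then (k - s) choose (j - s) else 0)"
    if Q: "Q \<in> maximal_faces C" for Q
  proof (cases "F \<subseteq> Q")
    case True
    have QC: "Q \<in> C" using Q maximal_faces_in_complex by blast
    have FQ: "F face_of Q"
      using face_of_iff_subset[OF QC] FC True by blast
    have "{G \<in> ?G. G \<subseteq> Q} = {G. G face_of Q \<and> F \<subseteq> G \<and> G \<subseteq> Q \<and> face_rank G = j}"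
      using face_of_iff_subset[OF QC] by (auto simp: rank_faces_def)
    moreover have "Q face_of Q"
      using QC face_of_iff_subset by blast
    ultimately show ?thesis
      using card_interval_faces[OF simple[OF Q] FQ FC(3), of Q j] True FC s face_rank_maximal[OF Q]
      by simp
  next
    case False
    then have "{G \<in> ?G. G \<subseteq> Q} = {}" by auto
    then have "card {G \<in> ?G. G \<subseteq> Q} = 0" by (simp only: card.empty)
    with False show ?thesis by simp
  qed
  have "(\<Sum>G\<in>?G. maximal_degree G) =
        (\<Sum>Q\<in>maximal_faces C. card {G \<in> ?G. G \<subseteq> Q})"
    unfolding maximal_degree_def
    using finG finite_maximal_faces by (intro sum_multicount_gen) auto
  also have "\<dots> = (\<Sum>Q\<in>maximal_faces C. if F \<subseteq> Q then (k - s) choose (j - s) else 0)"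
    using inQ by (rule sum.cong[OF refl])
  also have "\<dots> = ((k - s) choose (j - s)) * maximal_degree F"
    using finite_maximal_faces by (simp add: sum.If_cases maximal_degree_def Int_def)
  finally show ?thesis .
qed

lemma choose_le_card_rank_faces_below:
  assumes G: "G \<in> rank_faces b" and "0 < a" "0 < b"
  shows "b choose a \<le> card {F \<in> rank_faces a. F \<subseteq> G}"
proof -
  have GC: "G \<in> C" "face_rank G = b" "G \<noteq> {}"
    using assms by (auto simp: rank_faces_def face_rank_def)
  obtain Q where Q: "Q \<in> maximal_faces C" "G \<subseteq> Q"
    using maximal_above GC by blast
  have "G face_of Q"
    using face_of_iff_subset GC Q maximal_faces_in_complex by blast
  moreover have "{F. F face_of G \<and> face_rank F = a} = {F \<in> rank_faces a. F \<subseteq> G}"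
    using face_of_iff_subset[OF GC(1)] by (auto simp: rank_faces_def)
  ultimately show ?thesis
    using choose_le_card_faces[OF simple[OF Q(1)], of G a] GC assms by simp
qed


section \<open>Flag degrees\<close>

lemma flags_from_singleton:
  assumes "F \<in> rank_faces s"
  shows "flags_from C [s] F = {[F]}"
proof (intro equalityI subsetI)
  fix X assume "X \<in> flags_from C [s] F"
  then show "X \<in> {[F]}"
    by (cases X) (auto simp: flags_from_def)
qed (use assms in \<open>auto simp: flags_from_def rank_faces_def\<close>)

text \<open>Removing the first face of a flag leaves a flag for the composition in which the first two parts
  are merged. The condition \<^prop>\<open>0 < s'\<close> turns the inclusion \<open>F \<subseteq> G\<close> into a strict one.\<close>

lemma flags_from_Cons_Cons:
  assumes F: "F \<in> rank_faces s" and "0 < s'"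
  shows "flags_from C (s # s' # ss) F =
         (\<Union>G\<in>{G. G \<in> rank_faces (s + s') \<and> F \<subseteq> G}. (#) F ` flags_from C ((s + s') # ss) G)"
proof (intro equalityI subsetI)
  fix X assume X: "X \<in> flags_from C (s # s' # ss) F"
  then obtain G Y where XY: "X = F # G # Y"
    by (cases X; cases "tl X") (auto simp: flags_from_def)
  have rank: "face_rank (X ! j) = sum_list (take (Suc j) (s # s' # ss))"
    if "j < Suc (Suc (length ss))" for j
    using X that by (auto simp: flags_from_def)
  have "G \<in> rank_faces (s + s')" "F \<subset> G"
    using X rank[of 1] by (auto simp: XY flags_from_def rank_faces_def)
  moreover have "G # Y \<in> flags_from C ((s + s') # ss) G"
    using X rank[of "Suc _"] by (auto simp: XY flags_from_def add.assoc)
  ultimately show "X \<in> (\<Union>G\<in>{G. G \<in> rank_faces (s + s') \<and> F \<subseteq> G}.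
                        (#) F ` flags_from C ((s + s') # ss) G)"
    by (auto simp: XY)
next
  fix X assume "X \<in> (\<Union>G\<in>{G. G \<in> rank_faces (s + s') \<and> F \<subseteq> G}.
                    (#) F ` flags_from C ((s + s') # ss) G)"
  then obtain G Y where G: "G \<in> rank_faces (s + s')" "F \<subseteq> G"
    and Y: "Y \<in> flags_from C ((s + s') # ss) G" and X: "X = F # Y"
    by auto
  obtain Z where Z: "Y = G # Z"
    using Y by (cases Y) (auto simp: flags_from_def)
  have "F \<subset> G"
    using G F \<open>0 < s'\<close> by (auto simp: rank_faces_def)
  then have "sorted_wrt (\<subset>) X"
    using Y by (auto simp: X Z flags_from_def)
  moreover have "face_rank (X ! j) = sum_list (take (Suc j) (s # s' # ss))"
    if "j < Suc (Suc (length ss))" for j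
  proof (cases j)
    case 0
    then show ?thesis using F X by (simp add: rank_faces_def)
  next
    case (Suc i)
    then show ?thesis using Y that by (auto simp: X flags_from_def add.assoc)
  qed
  ultimately show "X \<in> flags_from C (s # s' # ss) F"
    using Y F by (auto simp: X flags_from_def rank_faces_def)
qed

lemma finite_flags_from: "finite (flags_from C \<sigma> F)"
proof (rule finite_subset)
  show "flags_from C \<sigma> F \<subseteq> {X. set X \<subseteq> C \<and> length X = length \<sigma>}"
    by (auto simp: flags_from_def)
qed (rule finite_lists_length_eq[OF finite_complex])

lemma flag_degree_Cons_Cons:
  assumes F: "F \<in> rank_faces s" and "0 < s'"
  shows "flag_degree C (s # s' # ss) F =
         (\<Sum>G | G \<in> rank_faces (s + s') \<and> F \<subseteq> G. flag_degree C ((s + s') # ss) G)"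
  unfolding flag_degree_def flags_from_Cons_Cons[OF assms]
proof (subst card_UN_disjoint)
  show "\<forall>G\<in>{G. G \<in> rank_faces (s + s') \<and> F \<subseteq> G}.
          \<forall>H\<in>{G. G \<in> rank_faces (s + s') \<and> F \<subseteq> G}. G \<noteq> H \<longrightarrow>
          (#) F ` flags_from C ((s + s') # ss) G \<inter> (#) F ` flags_from C ((s + s') # ss) H = {}"
    by (auto simp: flags_from_def)
qed (auto simp: finite_rank_faces finite_flags_from card_image)

text \<open>The number of flags from \<open>F\<close> is a multinomial coefficient times the number of maximal faces
  containing \<open>F\<close>.\<close>

lemma flag_degree_eq:
  assumes "F \<in> rank_faces s" "0 < s" "\<forall>i\<in>set ss. 0 < i" "s + sum_list ss = k"
  shows "flag_degree C (s # ss) F * prod_list (map fact ss) = fact (k - s) * maximal_degree F"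
  using assms
proof (induction ss arbitrary: s F)
  case Nil
  then show ?case
    using maximal_degree_top by (simp add: flag_degree_def flags_from_singleton)
next
  case (Cons s' ss)
  let ?G = "{G. G \<in> rank_faces (s + s') \<and> F \<subseteq> G}"
  have "flag_degree C (s # s' # ss) F * prod_list (map fact (s' # ss)) =
        fact s' * (\<Sum>G\<in>?G. flag_degree C ((s + s') # ss) G * prod_list (map fact ss))"
    using Cons.prems by (simp add: flag_degree_Cons_Cons sum_distrib_left sum_distrib_right mult_ac)
  also have "(\<Sum>G\<in>?G. flag_degree C ((s + s') # ss) G * prod_list (map fact ss)) =
             (\<Sum>G\<in>?G. fact (k - (s + s')) * maximal_degree G)"
    using Cons.prems by (intro sum.cong refl Cons.IH) auto
  also have "\<dots> = fact (k - (s + s')) * (((k - s) choose s') * maximal_degree F)"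
    using Cons.prems sum_maximal_degree_above[of F s "s + s'"]
    by (simp flip: sum_distrib_left)
  also have "fact s' * \<dots> =
      (fact s' * fact ((k - s) - s') * ((k - s) choose s')) * maximal_degree F"
    by (simp add: mult_ac)
  also have "fact s' * fact ((k - s) - s') * ((k - s) choose s') = fact (k - s)"
    using Cons.prems by (intro binomial_fact_lemma) auto
  finally show ?case .
qed


section \<open>Comparison of truncated degree sums\<close>

text \<open>Subtraction of natural numbers is truncated at zero, so \<open>d - t\<close> stands for the
  positive part of the difference.\<close>

lemma truncated_sum_flag_degree_le:
  assumes \<sigma>: "is_composition (a # \<alpha>) k" and \<pi>: "is_composition (b # \<beta>) k"
    and perm: "mset (b # \<beta>) = mset (a # \<alpha>)" and "a \<le> b"
  shows "(\<Sum>G\<in>rank_faces b. flag_degree C (b # \<beta>) G - t) \<le>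
         (\<Sum>F\<in>rank_faces a. flag_degree C (a # \<alpha>) F - t)"
proof -
  have pos: "0 < a" "0 < b" "\<forall>i\<in>set \<alpha>. 0 < i" "\<forall>i\<in>set \<beta>. 0 < i"
    and sums: "a + sum_list \<alpha> = k" "b + sum_list \<beta> = k"
    using \<sigma> \<pi> by (auto simp: is_composition_def)
  define n where "n F = real (maximal_degree F)" for F
  define D where "D = (prod_list (map fact (a # \<alpha>)) :: nat)"
  have D_eq: "D = prod_list (map fact (b # \<beta>))"
    unfolding D_def by (metis mset_map perm prod_mset_prod_list)
  have D_pos: "0 < D"
    by (simp add: D_def prod_list_zero_iff flip: neq0_conv) (auto simp: image_iff)
  define M where "M j = fact j * fact (k - j) / real D" for j
  have degree_a: "real (flag_degree C (a # \<alpha>) F) = M a * n F" if "F \<in> rank_faces a" for F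
  proof -
    have "flag_degree C (a # \<alpha>) F * D = fact a * fact (k - a) * maximal_degree F"
      using flag_degree_eq[OF that] pos sums by (simp add: D_def mult_ac)
    then have "real (flag_degree C (a # \<alpha>) F) * real D = fact a * fact (k - a) * n F"
      unfolding n_def by (metis of_nat_fact of_nat_mult)
    then show ?thesis
      using D_pos by (simp add: M_def field_simps)
  qed
  have degree_b: "real (flag_degree C (b # \<beta>) G) = M b * n G" if "G \<in> rank_faces b" for G
  proof -
    have "flag_degree C (b # \<beta>) G * D = fact b * fact (k - b) * maximal_degree G"
      using flag_degree_eq[OF that] pos sums by (simp add: D_eq mult_ac)
    then have "real (flag_degree C (b # \<beta>) G) * real D = fact b * fact (k - b) * n G"
      unfolding n_def by (metis of_nat_fact of_nat_mult)
    then show ?thesis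
      using D_pos by (simp add: M_def field_simps)
  qed
  define L where "L = real (b choose a)"
  define U where "U = real ((k - a) choose (b - a))"
  have "b choose a \<le> (k - a) choose (b - a)"
  proof (cases "a = b")
    case False
    with perm have "a \<in> set \<beta>"
      by (metis list.set_intros(1) set_ConsD set_mset_mset)
    then have "b \<le> k - a"
      using sums member_le_sum_list[of a \<beta>] by simp
    then show ?thesis
      using binomial_symmetric[OF \<open>a \<le> b\<close>] binomial_right_mono by metis
  qed simp
  then have LU: "L \<le> U" by (simp add: L_def U_def)
  have U_pos: "0 < U"
    using sums \<open>a \<le> b\<close> by (simp add: U_def)
  have choose_M: "M j * real (k choose j) = fact k / real D" if "j \<le> k" for j
  proof -
    have "fact j * fact (k - j) * real (k choose j) = fact k"
      using binomial_fact_lemma[OF that] by (metis of_nat_fact of_nat_mult)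
    then show ?thesis by (simp add: M_def)
  qed
  \<comment> \<open>\<open>M j\<close> is inversely proportional to \<open>k choose j\<close>, and both sides of
    \<open>(k choose b) (b choose a) = (k choose a) ((k - a) choose (b - a))\<close> count pairs of nested subsets.\<close>
  have choose_ratio: "M a * L = M b * U"
  proof -
    have "real (k choose b) * L = real (k choose a) * U"
      using choose_mult[of a b k] sums \<open>a \<le> b\<close> unfolding L_def U_def
      by (metis le_add1 of_nat_mult)
    then have "(M a * L) * real (k choose b) = (M a * real (k choose a)) * U"
      by (simp add: mult_ac)
    also have "\<dots> = (M b * U) * real (k choose b)"
      using choose_M[of a] choose_M[of b] sums by (simp add: mult_ac)
    finally show ?thesis
      using sums by simp
  qed
  have n_pos: "0 < n F" if "F \<in> rank_faces j" for F j
    using that maximal_degree_pos by (auto simp: n_def rank_faces_def)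
  define w where "w F = max 0 (M a - real t / n F)" for F
  have w_eq: "n F * w F = max 0 (M a * n F - real t)" if "0 < n F" for F
  proof -
    have "n F * (M a - real t / n F) = M a * n F - real t"
      using that by (simp add: field_simps)
    then show ?thesis
      using that by (simp add: w_def max_mult_distrib_left)
  qed
  have trunc: "real (x - t) = max 0 (real x - real t)" for x
    by (simp add: max_def)
  have "U * real (\<Sum>F\<in>rank_faces a. flag_degree C (a # \<alpha>) F - t) =
        (\<Sum>F\<in>rank_faces a. w F * (U * n F))"
    using w_eq n_pos degree_a by (simp add: trunc sum_distrib_left mult_ac)
  also have "\<dots> = (\<Sum>F\<in>rank_faces a. \<Sum>G | G \<in> rank_faces b \<and> F \<subseteq> G. w F * n G)"
  proof (rule sum.cong[OF refl])
    fix F assume "F \<in> rank_faces a"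
    then have "(\<Sum>G | G \<in> rank_faces b \<and> F \<subseteq> G. n G) = U * n F"
      using sum_maximal_degree_above[of F a b] pos \<open>a \<le> b\<close> unfolding n_def U_def
      by (metis of_nat_mult of_nat_sum)
    then show "w F * (U * n F) = (\<Sum>G | G \<in> rank_faces b \<and> F \<subseteq> G. w F * n G)"
      by (simp flip: sum_distrib_left)
  qed
  also have "\<dots> = (\<Sum>G\<in>rank_faces b. \<Sum>F | F \<in> rank_faces a \<and> F \<subseteq> G. w F * n G)"
    using finite_rank_faces by (rule sum.swap_restrict) (rule finite_rank_faces)
  also have "\<dots> \<ge> (\<Sum>G\<in>rank_faces b. U * real (flag_degree C (b # \<beta>) G - t))"
  proof (rule sum_mono)
    fix G assume G: "G \<in> rank_faces b"
    \<comment> \<open>Truncated at zero, this is \<open>U (M b N(G) - t) \<le> L (M a N(G) - t)\<close>, by \<open>M a L = M b U\<close> and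
      \<open>L \<le> U\<close>.\<close>
    have "U * (M b * n G - real t) = L * (M a * n G - real t) - (U - L) * real t"
      using choose_ratio by (simp add: algebra_simps)
    also have "\<dots> \<le> L * (M a * n G - real t)"
      using LU by simp
    finally have "U * real (flag_degree C (b # \<beta>) G - t) \<le> L * (n G * w G)"
      using n_pos[OF G] U_pos LU
      by (simp add: trunc degree_b[OF G] w_eq max_mult_distrib_left L_def max.coboundedI2)
    also have "\<dots> \<le> real (card {F. F \<in> rank_faces a \<and> F \<subseteq> G}) * (n G * w G)"
      using choose_le_card_rank_faces_below[OF G] pos
      by (intro mult_right_mono) (auto simp: L_def n_def w_def)
    also have "\<dots> = (\<Sum>F | F \<in> rank_faces a \<and> F \<subseteq> G. w G * n G)"
      by simp
    also have "\<dots> \<le> (\<Sum>F | F \<in> rank_faces a \<and> F \<subseteq> G. w F * n G)"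
    proof (rule sum_mono)
      fix F assume F: "F \<in> {F. F \<in> rank_faces a \<and> F \<subseteq> G}"
      have "n G \<le> n F"
        using F maximal_degree_antimono by (simp add: n_def)
      then have "real t / n F \<le> real t / n G"
        using n_pos[OF G] by (simp add: frac_le)
      then have "w G \<le> w F"
        by (simp add: w_def)
      then show "w G * n G \<le> w F * n G"
        by (simp add: n_def mult_right_mono)
    qed
    finally show "U * real (flag_degree C (b # \<beta>) G - t) \<le>
                  (\<Sum>F | F \<in> rank_faces a \<and> F \<subseteq> G. w F * n G)" .
  qed
  finally have "U * real (\<Sum>G\<in>rank_faces b. flag_degree C (b # \<beta>) G - t) \<le>
                U * real (\<Sum>F\<in>rank_faces a. flag_degree C (a # \<alpha>) F - t)"
    by (simp add: sum_distrib_left)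
  then show ?thesis
    using U_pos by (simp only: mult_le_cancel_left_pos of_nat_le_iff)
qed

end


section \<open>Weak majorization\<close>

text \<open>With threshold \<open>t\<close> equal to the entry of \<open>xs\<close> at index \<open>r\<close>, the truncated sum of \<open>xs\<close> is the
  sum of its first \<open>r\<close> entries minus \<open>r t\<close>, whereas the truncated sum of \<open>ys\<close> is at least
  that expression for \<open>ys\<close>. Only \<open>xs\<close> needs to be in decreasing order.\<close>

lemma weakly_majorizes_if_truncated_sums_le:
  assumes sorted: "sorted (rev xs)"
    and le: "\<And>t. (\<Sum>y\<leftarrow>ys. y - t) \<le> (\<Sum>x\<leftarrow>xs. x - t)"
  shows "weakly_majorizes xs ys"
  unfolding weakly_majorizes_def
proof (intro conjI allI impI)
  show "sum_list ys \<le> sum_list xs"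
    using le[of 0] by simp
next
  fix r assume r: "1 \<le> r \<and> r < length xs"
  define t where "t = xs ! r"
  have above: "t \<le> x" if "x \<in> set (take r xs)" for x
  proof -
    obtain i where "i < r" "x = xs ! i"
      using \<open>x \<in> set (take r xs)\<close> r by (auto simp: in_set_conv_nth)
    then show ?thesis
      using sorted_rev_nth_mono[OF sorted, of i r] r by (simp add: t_def)
  qed
  have below: "x - t = 0" if "x \<in> set (drop r xs)" for x
  proof -
    obtain i where "i < length xs - r" "x = xs ! (r + i)"
      using \<open>x \<in> set (drop r xs)\<close> by (auto simp: in_set_conv_nth)
    then show ?thesis
      using sorted_rev_nth_mono[OF sorted, of r "r + i"] r by (simp add: t_def)
  qed
  have "sum_list (take r ys) \<le> (\<Sum>y\<leftarrow>take r ys. (y - t) + t)"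
    using sum_list_mono[of "take r ys" "\<lambda>y. y" "\<lambda>y. (y - t) + t"] by simp
  also have "\<dots> = (\<Sum>y\<leftarrow>take r ys. y - t) + length (take r ys) * t"
    by (simp add: sum_list_addf sum_list_triv)
  also have "(\<Sum>y\<leftarrow>take r ys. y - t) \<le> (\<Sum>y\<leftarrow>take r ys. y - t) + (\<Sum>y\<leftarrow>drop r ys. y - t)"
    by simp
  also have "\<dots> = (\<Sum>y\<leftarrow>ys. y - t)"
    by (metis append_take_drop_id map_append sum_list_append)
  also have "\<dots> \<le> (\<Sum>x\<leftarrow>xs. x - t)"
    by (rule le)
  also have "\<dots> = (\<Sum>x\<leftarrow>take r xs. x - t) + (\<Sum>x\<leftarrow>drop r xs. x - t)"
    by (metis append_take_drop_id map_append sum_list_append)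
  also have "(\<Sum>x\<leftarrow>drop r xs. x - t) = 0"
    using below by (simp add: sum_list_eq_0_iff)
  also have "length (take r ys) * t \<le> r * t"
    by (simp add: mult_right_mono)
  also have "(\<Sum>x\<leftarrow>take r xs. x - t) + 0 + r * t = (\<Sum>x\<leftarrow>take r xs. (x - t) + t)"
    using r by (simp add: sum_list_addf sum_list_triv)
  also have "\<dots> = sum_list (take r xs)"
    using above by (metis (no_types, lifting) le_add_diff_inverse2 map_idI)
  finally show "sum_list (take r ys) \<le> sum_list (take r xs)"
    by simp
qed

lemma sorted_rev_degree_sequence: "sorted (rev (degree_sequence C \<sigma>))"
  by (simp add: degree_sequence_def)

lemma truncated_sum_degree_sequence:
  "(\<Sum>x\<leftarrow>degree_sequence C \<sigma>. x - t) =
   (\<Sum>F\<in>{F \<in> C. face_rank F = hd \<sigma>}. flag_degree C \<sigma> F - t)"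
proof -
  have "(\<Sum>x\<leftarrow>degree_sequence C \<sigma>. x - t) =
        sum_mset (image_mset (\<lambda>x. x - t) (mset (degree_sequence C \<sigma>)))"
    by (metis mset_map sum_mset_sum_list)
  then show ?thesis
    by (simp add: degree_sequence_def sum_unfold_sum_mset multiset.map_comp comp_def)
qed

theorem theorem4p3:
  fixes C :: "'a::euclidean_space set set"
    and P :: "'b::euclidean_space set"
    and k :: nat
    and \<sigma> \<pi> :: "nat list"
  assumes "finite C"
    and "polyhedral_complex C"
    and "pure_of_rank k C"
    and "simple_polytope P"
    and "\<And>F. F \<in> maximal_faces C \<Longrightarrow> comb_equivalent F P"
    and "is_composition \<sigma> k"
    and "\<sigma> \<noteq> []"
    and "mset \<pi> = mset \<sigma>"
    and "hd \<pi> \<ge> hd \<sigma>"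
  shows "weakly_majorizes (degree_sequence C \<sigma>) (degree_sequence C \<pi>)"
proof -
  interpret pure_simple_complex C k
  proof
    fix Q assume Q: "Q \<in> maximal_faces C"
    then have "polytope Q"
      using assms(2) by (simp add: maximal_faces_def polyhedral_complex_def)
    then show "simple_polytope Q"
      using Q assms(4,5) simple_polytope_comb_equivalent by blast
  qed (use assms in auto)
  obtain a \<alpha> where \<sigma>: "\<sigma> = a # \<alpha>"
    using assms(7) by (cases \<sigma>) auto
  obtain b \<beta> where \<pi>: "\<pi> = b # \<beta>"
    using assms(7,8) by (cases \<pi>) auto
  have \<pi>_comp: "is_composition \<pi> k"
    using assms(6,8) unfolding is_composition_def by (metis set_mset_mset sum_mset_sum_list)
  have "(\<Sum>G\<in>rank_faces b. flag_degree C \<pi> G - t) \<le> (\<Sum>F\<in>rank_faces a. flag_degree C \<sigma> F - t)"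
    for t
    using truncated_sum_flag_degree_le[of a \<alpha> b \<beta> t] assms(6,8,9) \<pi>_comp by (simp add: \<sigma> \<pi>)
  then show ?thesis
    by (intro weakly_majorizes_if_truncated_sums_le sorted_rev_degree_sequence)
      (simp add: truncated_sum_degree_sequence \<sigma> \<pi> rank_faces_def)
qed

end
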